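(* For every $0<C<2$ and every $\varepsilon_0>0$ there are $n,d\ge1$ and rational, real, rank-one matrices $A_1,\dots,A_n\succeq0$ of size $d\times d$ such that $$\sum_iA_i=I_d,\qquad0<\varepsilon(A)<\varepsilon_0,\qquad\Delta(A)>C\sqrt{\varepsilon(A)}.$$ Consequently, every universal Kadison–Singer signing coefficient is at least $2$; that is, if $C$ is a constant such that $\Delta(A)\le C\sqrt{\varepsilon(A)}$ for every finite family $A$ of positive semidefinite matrices (of any size $d$) with $\sum_iA_i=I_d$, then $C\ge2$.
   Context: For a family $A=(A_1,\dots,A_n)$ of positive semidefinite $d\times d$ matrices with $\sum_iA_i=I_d$, $\Delta(A)=\min_{s\in\{-1,1\}^n}\|\sum_is_iA_i\|$ (operator norm) and $\varepsilon(A)=\max_i\operatorname{tr}(A_i)$. Rational means all entries are rational. *)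

theory Defs
  imports
    "HOL-Analysis.L2_Norm"
    "HOL-Library.FuncSet"
    "Jordan_Normal_Form.Schur_Decomposition"
    "Jordan_Normal_Form.DL_Rank"
begin

(* Matrices are complex, with the size d an explicit natural number; a family A_1, ..., A_n is a
   function on the index set {..<n}. *)

definition psd :: "nat \<Rightarrow> complex mat \<Rightarrow> bool" where
  "psd d A \<longleftrightarrow> A \<in> carrier_mat d d \<and> mat_adjoint A = A \<and>
     (\<forall>v\<in>carrier_vec d. 0 \<le> Re ((A *\<^sub>v v) \<bullet>c v))"

definition mat_trace :: "complex mat \<Rightarrow> complex" where
  "mat_trace A = (\<Sum>j<dim_row A. A $$ (j, j))"

definition mat_sum :: "nat \<Rightarrow> nat \<Rightarrow> (nat \<Rightarrow> complex mat) \<Rightarrow> complex mat" where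
  "mat_sum d n A = mat d d (\<lambda>(j, k). \<Sum>i<n. A i $$ (j, k))"

definition l2_norm :: "complex vec \<Rightarrow> real" where
  "l2_norm v = L2_set (\<lambda>j. cmod (v $ j)) {..<dim_vec v}"

definition op_norm :: "complex mat \<Rightarrow> real" where
  "op_norm A = (SUP v\<in>{v \<in> carrier_vec (dim_col A). l2_norm v \<le> 1}. l2_norm (A *\<^sub>v v))"

definition psd_resolution :: "nat \<Rightarrow> nat \<Rightarrow> (nat \<Rightarrow> complex mat) \<Rightarrow> bool" where
  "psd_resolution d n A \<longleftrightarrow> (\<forall>i<n. psd d (A i)) \<and> mat_sum d n A = 1\<^sub>m d"

(* The trace of a positive semidefinite matrix is real, so Re loses nothing. *)
definition max_trace :: "nat \<Rightarrow> (nat \<Rightarrow> complex mat) \<Rightarrow> real" where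
  "max_trace n A = Max ((\<lambda>i. Re (mat_trace (A i))) ` {..<n})"

definition signing_discrepancy :: "nat \<Rightarrow> nat \<Rightarrow> (nat \<Rightarrow> complex mat) \<Rightarrow> real" where
  "signing_discrepancy d n A =
     Min ((\<lambda>s. op_norm (mat_sum d n (\<lambda>i. s i \<cdot>\<^sub>m A i))) ` ({..<n} \<rightarrow>\<^sub>E {-1, 1}))"

definition universal_KS_signing_coefficient :: "real \<Rightarrow> bool" where
  "universal_KS_signing_coefficient C \<longleftrightarrow>
     (\<forall>n d A. n \<ge> 1 \<longrightarrow> d \<ge> 1 \<longrightarrow> psd_resolution d n A \<longrightarrow>
        signing_discrepancy d n A \<le> C * sqrt (max_trace n A))"

(* The rationals as a subset of the complex numbers: rational entries are in particular real. *)
definition rational_mat :: "complex mat \<Rightarrow> bool" where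
  "rational_mat A \<longleftrightarrow> elements_mat A \<subseteq> \<rat>"

end

theory Submission
  imports Defs
begin

text \<open>
  The matrices have the form \<open>A\<^sub>c = w\<^sub>c w\<^sub>c\<^sup>T\<close> with real vectors \<open>w\<^sub>c\<close>. That they sum to the identity
  means that \<open>y \<mapsto> (\<langle>w\<^sub>c, y\<rangle>)\<^sub>c\<close> preserves the norm, and every \<open>y \<noteq> 0\<close> gives the lower bound
  \<open>\<bar>\<Sum>\<^sub>c s\<^sub>c \<langle>w\<^sub>c, y\<rangle>\<^sup>2\<bar> / \<bar>y\<bar>\<^sup>2\<close> for the norm of the signed sum. So every signing \<open>s\<close> needs a test
  vector for which this ratio is almost \<open>2 sqrt \<epsilon>\<close>.

  The vectors come from a rooted tree in which every vertex has \<open>m = q\<^sup>2\<close> children. Place a real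
  number \<open>x\<^sub>c\<close> at every vertex \<open>c < d\<close>, and let the edge from \<open>c\<close> to its parent \<open>p\<close> read
  \<open>\<beta> q x\<^sub>c + x\<^sub>p\<close> (with \<open>x\<^sub>p = 0\<close> at the root). Where the tree is cut off, the edges to the missing
  children are kept as stubs that read \<open>\<gamma> x\<^sub>p\<close>. Here \<open>\<beta>\<^sup>2 + \<gamma>\<^sup>2 = 1\<close>. In the coordinates
  \<open>y\<^sub>c = q x\<^sub>c + \<beta> x\<^sub>p\<close> these readings form an isometry, since
  \<open>(\<beta> q x\<^sub>c + x\<^sub>p)\<^sup>2 = (q x\<^sub>c + \<beta> x\<^sub>p)\<^sup>2 + \<gamma>\<^sup>2 (x\<^sub>p\<^sup>2 - m x\<^sub>c\<^sup>2)\<close> and the corrections cancel when summed over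
  all edges and stubs, each vertex being the parent of exactly \<open>m\<close> of them
  (\<open>edges_resolve_identity\<close>). The vector of an edge has squared norm at most \<open>\<beta>\<^sup>2 + 2 / m\<close>
  (\<open>edge_norm\<close>).

  Given signs \<open>s\<close>, take \<open>\<bar>x\<^sub>c\<bar> = \<bar>x\<^sub>p\<bar> / q\<close>, which puts the same mass on every level, and choose the
  sign of \<open>x\<^sub>c\<close> so that the cross term \<open>2 \<beta> q s\<^sub>c x\<^sub>c x\<^sub>p\<close> of each edge is positive; in a tree this
  is possible, starting from the root. The remaining terms of \<open>\<Sum>\<^sub>c s\<^sub>c \<langle>w\<^sub>c, y\<rangle>\<^sup>2\<close> involve only the
  squares \<open>x\<^sub>c\<^sup>2\<close>, which do not depend on \<open>s\<close>. Hence they are linear in \<open>s\<close>, and they are nonnegative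
  for \<open>s\<close> or for \<open>- s\<close>, whose signed sums have the same norm. The cross terms contribute \<open>2 \<beta> m\<close> per
  level, whereas \<open>\<bar>y\<bar>\<^sup>2\<close> is at most \<open>m (1 + \<beta>)\<^sup>2\<close> per level, so that in a deep tree the ratio comes
  close to \<open>2 \<beta> / (1 + \<beta>)\<^sup>2\<close> (\<open>signed_lower_bound\<close>). Compared with \<open>sqrt (\<beta>\<^sup>2 + 2 / m)\<close>, it approaches
  \<open>2\<close> when \<open>\<beta>\<close> is small and \<open>m\<close> is large. All entries are rational because \<open>m\<close> is a square and
  \<open>(\<beta>, \<gamma>)\<close> is chosen as a rational point of the unit circle.
\<close>

section \<open>Families of rank-one matrices\<close>

definition outer :: "nat \<Rightarrow> (nat \<Rightarrow> real) \<Rightarrow> complex mat" where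
  "outer d w = mat d d (\<lambda>(j, k). complex_of_real (w j * w k))"

lemma outer_carrier [simp]: "outer d w \<in> carrier_mat d d"
  by (simp add: outer_def)

lemma trace_outer: "mat_trace (outer d w) = complex_of_real (\<Sum>j<d. (w j)\<^sup>2)"
  by (simp add: mat_trace_def outer_def power2_eq_square)

lemma rational_outer: "(\<And>j. w j \<in> \<rat>) \<Longrightarrow> rational_mat (outer d w)"
  by (auto simp: rational_mat_def elements_mat_def outer_def simp del: of_real_mult)

lemma psd_outer: "psd d (outer d w)"
proof -
  have adj: "mat_adjoint (outer d w) = outer d w"
    by (rule eq_matI) (auto simp: mat_adjoint_def outer_def mat_of_rows_def conjugate_complex_def)
  have "0 \<le> Re ((outer d w *\<^sub>v v) \<bullet>c v)" if v: "v \<in> carrier_vec d" for v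
  proof -
    define u where "u = (\<Sum>k<d. complex_of_real (w k) * v $ k)"
    have "(outer d w *\<^sub>v v) \<bullet>c v = (\<Sum>j<d. (\<Sum>k<d. of_real (w j * w k) * v $ k) * cnj (v $ j))"
      using v by (simp add: scalar_prod_def outer_def lessThan_atLeast0 conjugate_complex_def)
    also have "\<dots> = (\<Sum>j<d. u * cnj (of_real (w j) * v $ j))"
      by (simp add: u_def sum_distrib_left sum_distrib_right mult_ac)
    also have "\<dots> = u * cnj u"
      by (simp add: u_def sum_distrib_left cnj_sum)
    finally show ?thesis
      by (simp add: complex_mult_cnj)
  qed
  then show ?thesis by (simp add: psd_def adj)
qed

text \<open>A nonzero column is by itself a maximal linearly independent set of columns.\<close>

lemma (in vec_space) rank_eq_1_if_cols_multiples:
  assumes A: "A \<in> carrier_mat n nc" and u: "u \<in> set (cols A)" "u \<noteq> 0\<^sub>v n"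
    and mult: "\<And>v. v \<in> set (cols A) \<Longrightarrow> \<exists>a. v = a \<cdot>\<^sub>v u"
  shows "rank A = 1"
proof -
  have C: "set (cols A) \<subseteq> carrier_vec n" using A cols_dim by blast
  have uc: "u \<in> carrier_vec n" using C u by blast
  have li: "lin_indpt {u}"
  proof (rule finite_lin_indpt2)
    fix a assume a: "lincomb a {u} = 0\<^sub>v n"
    obtain i where i: "i < n" "u $ i \<noteq> 0"
      using u uc by (metis carrier_vecD eq_vecI index_zero_vec)
    have "lincomb a {u} $ i = a u * u $ i"
      using i uc by (subst lincomb_index) auto
    then show "\<forall>v\<in>{u}. a v = 0" using a i by simp
  qed (use uc in auto)
  have "maximal {u} (\<lambda>T. T \<subseteq> set (cols A) \<and> lin_indpt T)"
    unfolding maximal_def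
  proof (intro conjI allI impI)
    fix T assume T: "{u} \<subseteq> T \<and> T \<subseteq> set (cols A) \<and> lin_indpt T"
    have "v = u" if "v \<in> T" for v
    proof (rule ccontr)
      assume "v \<noteq> u"
      obtain a where a: "v = a \<cdot>\<^sub>v u" using mult \<open>v \<in> T\<close> T by blast
      have "v \<in> span {u}" using uc a by (simp add: span_mem smult_in_span)
      moreover have "lin_indpt ({u} \<union> {v})"
        using T \<open>v \<in> T\<close> subset_li_is_li[of T "{u} \<union> {v}"] by simp
      ultimately show False
        using lin_dep_iff_in_span[of "{u}" v] uc li a \<open>v \<noteq> u\<close> by simp
    qed
    then show "T = {u}" using T by blast
  qed (use u li in blast)+
  from rank_card_indpt[OF A this] show ?thesis by simp
qed

lemma rank_outer:
  assumes "k < d" "w k \<noteq> 0"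
  shows "vec_space.rank d (outer d w) = 1"
proof (rule vec_space.rank_eq_1_if_cols_multiples[of _ _ d "col (outer d w) k"])
  have c: "col (outer d w) j = vec d (\<lambda>i. of_real (w i * w j))" if "j < d" for j
    using that by (auto simp: outer_def)
  show "col (outer d w) k \<in> set (cols (outer d w))"
    using assms by (auto simp: cols_def outer_def)
  have "col (outer d w) k $ k \<noteq> 0" using assms c by simp
  then show "col (outer d w) k \<noteq> 0\<^sub>v d" using assms by auto
  fix v assume "v \<in> set (cols (outer d w))"
  then obtain j where "j < d" "v = col (outer d w) j"
    by (auto simp: cols_def outer_def)
  then have "v = of_real (w j / w k) \<cdot>\<^sub>v col (outer d w) k"
    using c assms by (intro eq_vecI) (auto simp: field_simps)
  then show "\<exists>a. v = a \<cdot>\<^sub>v col (outer d w) k" by blast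
qed simp

lemma l2_norm_smult: "l2_norm (a \<cdot>\<^sub>v v) = cmod a * l2_norm v"
  by (simp add: l2_norm_def L2_set_right_distrib norm_mult cong: L2_set_cong_simp)

text \<open>The operator norm is a supremum of reals, so it is an upper bound only once the values are known
  to be bounded; the sum of the moduli of all entries serves as a crude bound.\<close>

lemma op_norm_bound:
  assumes A: "A \<in> carrier_mat d d" and v: "v \<in> carrier_vec d"
  shows "l2_norm (A *\<^sub>v v) \<le> op_norm A * l2_norm v"
proof (cases "l2_norm v = 0")
  case True
  then have "\<forall>j<d. v $ j = 0"
    using v by (auto simp: l2_norm_def L2_set_eq_0_iff)
  then have "A *\<^sub>v v = 0\<^sub>v d"
    using A v by (intro eq_vecI) (auto simp: scalar_prod_def)
  then show ?thesis using True by (simp add: l2_norm_def L2_set_def)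
next
  case False
  then have pos: "0 < l2_norm v" by (simp add: l2_norm_def less_le)
  have bdd: "bdd_above ((\<lambda>u. l2_norm (A *\<^sub>v u)) ` {u \<in> carrier_vec (dim_col A). l2_norm u \<le> 1})"
  proof (rule bdd_aboveI2)
    fix u assume u: "u \<in> {u \<in> carrier_vec (dim_col A). l2_norm u \<le> 1}"
    then have ud: "u \<in> carrier_vec d" using A by auto
    have u1: "cmod (u $ k) \<le> 1" if "k < d" for k
      using member_le_L2_set[of "{..<d}" k "\<lambda>j. cmod (u $ j)"] u ud that
      by (auto simp: l2_norm_def)
    have "l2_norm (A *\<^sub>v u) \<le> (\<Sum>j<d. cmod ((A *\<^sub>v u) $ j))"
      using A unfolding l2_norm_def by (simp add: L2_set_le_sum del: index_mult_mat_vec)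
    also have "\<dots> \<le> (\<Sum>j<d. \<Sum>k<d. cmod (A $$ (j, k)))"
    proof (rule sum_mono)
      fix j assume j: "j \<in> {..<d}"
      have "cmod ((A *\<^sub>v u) $ j) = cmod (\<Sum>k<d. A $$ (j, k) * u $ k)"
        using A ud j by (simp add: scalar_prod_def lessThan_atLeast0)
      also have "\<dots> \<le> (\<Sum>k<d. cmod (A $$ (j, k) * u $ k))" by (rule norm_sum)
      also have "\<dots> \<le> (\<Sum>k<d. cmod (A $$ (j, k)))"
        using u1 by (intro sum_mono) (simp add: norm_mult mult_left_le)
      finally show "cmod ((A *\<^sub>v u) $ j) \<le> (\<Sum>k<d. cmod (A $$ (j, k)))" .
    qed
    finally show "l2_norm (A *\<^sub>v u) \<le> (\<Sum>j<d. \<Sum>k<d. cmod (A $$ (j, k)))" .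
  qed
  define u where "u = complex_of_real (1 / l2_norm v) \<cdot>\<^sub>v v"
  have "u \<in> {u \<in> carrier_vec (dim_col A). l2_norm u \<le> 1}"
    using pos v A by (simp add: u_def l2_norm_smult norm_divide)
  then have "l2_norm (A *\<^sub>v u) \<le> op_norm A"
    unfolding op_norm_def by (rule cSUP_upper[OF _ bdd])
  moreover have "l2_norm (A *\<^sub>v u) = l2_norm (A *\<^sub>v v) / l2_norm v"
    using A v pos by (simp add: u_def mult_mat_vec l2_norm_smult norm_divide)
  ultimately show ?thesis using pos by (simp add: divide_simps)
qed

text \<open>This turns a real test vector \<open>y\<close> into a lower bound for the norm of a signed sum: the left side
  is the modulus of the quadratic form of that sum at \<open>y\<close>.\<close>

lemma signed_form_le_op_norm:
  fixes w :: "nat \<Rightarrow> nat \<Rightarrow> real" and s y :: "nat \<Rightarrow> real" and n d :: nat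
  defines "M \<equiv> mat_sum d n (\<lambda>i. complex_of_real (s i) \<cdot>\<^sub>m outer d (w i))"
  shows "\<bar>\<Sum>i<n. s i * (\<Sum>j<d. w i j * y j)\<^sup>2\<bar> \<le> op_norm M * (\<Sum>j<d. (y j)\<^sup>2)"
proof -
  have M: "M \<in> carrier_mat d d" by (simp add: M_def mat_sum_def)
  define v where "v = vec d (\<lambda>j. complex_of_real (y j))"
  have v: "v \<in> carrier_vec d" by (simp add: v_def)
  have lv: "l2_norm v = sqrt (\<Sum>j<d. (y j)\<^sup>2)"
    by (simp add: l2_norm_def v_def L2_set_def)
  define z where "z j = (\<Sum>i<n. s i * w i j * (\<Sum>k<d. w i k * y k))" for j
  have Mv: "(M *\<^sub>v v) $ j = complex_of_real (z j)" if "j < d" for j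
  proof -
    have "(M *\<^sub>v v) $ j = of_real (\<Sum>k<d. (\<Sum>i<n. s i * (w i j * w i k)) * y k)"
      using that by (simp add: M_def v_def mat_sum_def outer_def scalar_prod_def lessThan_atLeast0)
    also have "(\<Sum>k<d. (\<Sum>i<n. s i * (w i j * w i k)) * y k) = z j"
      unfolding z_def sum_distrib_left sum_distrib_right
      by (subst sum.swap) (simp add: mult_ac)
    finally show ?thesis .
  qed
  have "(\<Sum>i<n. s i * (\<Sum>j<d. w i j * y j)\<^sup>2) = (\<Sum>i<n. \<Sum>j<d. s i * w i j * (\<Sum>k<d. w i k * y k) * y j)"
    by (simp add: power2_eq_square sum_distrib_left sum_distrib_right mult_ac)
  also have "\<dots> = (\<Sum>j<d. z j * y j)"
    by (subst sum.swap) (simp add: z_def sum_distrib_right)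
  finally have "\<bar>\<Sum>i<n. s i * (\<Sum>j<d. w i j * y j)\<^sup>2\<bar> \<le> (\<Sum>j<d. \<bar>z j\<bar> * \<bar>y j\<bar>)"
    by (simp add: order_trans[OF sum_abs] abs_mult)
  also have "\<dots> \<le> L2_set z {..<d} * L2_set y {..<d}" by (rule L2_set_mult_ineq)
  also have "L2_set z {..<d} = l2_norm (M *\<^sub>v v)"
    using M Mv by (simp add: l2_norm_def L2_set_def)
  also have "L2_set y {..<d} = l2_norm v" by (simp add: lv L2_set_def)
  also have "l2_norm (M *\<^sub>v v) * l2_norm v \<le> op_norm M * l2_norm v * l2_norm v"
    using op_norm_bound[OF M v] by (rule mult_right_mono) (simp add: l2_norm_def)
  also have "\<dots> = op_norm M * (\<Sum>j<d. (y j)\<^sup>2)"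
    by (simp add: lv mult.assoc sum_nonneg flip: real_sqrt_mult power2_eq_square)
  finally show ?thesis .
qed

lemma resolution_outer:
  assumes "\<And>j k. j < d \<Longrightarrow> k < d \<Longrightarrow> (\<Sum>i<n. w i j * w i k) = (if j = k then 1 else 0)"
  shows "psd_resolution d n (\<lambda>i. outer d (w i))"
proof -
  have "mat_sum d n (\<lambda>i. outer d (w i)) = 1\<^sub>m d"
  proof (rule eq_matI)
    fix j k assume "j < dim_row (1\<^sub>m d)" "k < dim_col (1\<^sub>m d)"
    then have jk: "j < d" "k < d" by auto
    then have "mat_sum d n (\<lambda>i. outer d (w i)) $$ (j, k) = of_real (\<Sum>i<n. w i j * w i k)"
      by (simp add: mat_sum_def outer_def)
    then show "mat_sum d n (\<lambda>i. outer d (w i)) $$ (j, k) = 1\<^sub>m d $$ (j, k)"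
      unfolding assms[OF jk] using jk by simp
  qed (auto simp: mat_sum_def)
  then show ?thesis by (simp add: psd_resolution_def psd_outer)
qed

lemma discrepancy_outer_gt:
  assumes "\<And>s :: nat \<Rightarrow> real. (\<And>i. s i \<in> {-1, 1}) \<Longrightarrow>
     \<exists>y. 0 < (\<Sum>j<d. (y j)\<^sup>2) \<and>
         c * (\<Sum>j<d. (y j)\<^sup>2) < \<bar>\<Sum>i<n. s i * (\<Sum>j<d. w i j * y j)\<^sup>2\<bar>"
  shows "c < signing_discrepancy d n (\<lambda>i. outer d (w i))"
proof -
  have fin: "finite ({..<n} \<rightarrow>\<^sub>E {-1, 1 :: complex})" by (intro finite_PiE) auto
  have ne: "({..<n} \<rightarrow>\<^sub>E {-1, 1 :: complex}) \<noteq> {}" by (simp add: PiE_eq_empty_iff)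
  have "c < op_norm (mat_sum d n (\<lambda>i. t i \<cdot>\<^sub>m outer d (w i)))"
    if t: "t \<in> {..<n} \<rightarrow>\<^sub>E {-1, 1}" for t :: "nat \<Rightarrow> complex"
  proof -
    define s :: "nat \<Rightarrow> real" where "s i = (if t i = 1 then 1 else -1)" for i
    have st: "t i = complex_of_real (s i)" if "i < n" for i
      using PiE_mem[OF t, of i] that by (auto simp: s_def)
    have eq: "mat_sum d n (\<lambda>i. t i \<cdot>\<^sub>m outer d (w i))
        = mat_sum d n (\<lambda>i. complex_of_real (s i) \<cdot>\<^sub>m outer d (w i))"
      unfolding mat_sum_def by (rule cong_mat) (auto simp: st outer_def)
    have sgn: "s i \<in> {-1, 1}" for i by (simp add: s_def)
    from assms[of s, OF sgn] obtain y where y0: "0 < (\<Sum>j<d. (y j)\<^sup>2)"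
      and y: "c * (\<Sum>j<d. (y j)\<^sup>2) < \<bar>\<Sum>i<n. s i * (\<Sum>j<d. w i j * y j)\<^sup>2\<bar>"
      by (elim exE conjE)
    note y
    also note signed_form_le_op_norm[of s w y d n]
    finally have "c * (\<Sum>j<d. (y j)\<^sup>2)
        < op_norm (mat_sum d n (\<lambda>i. complex_of_real (s i) \<cdot>\<^sub>m outer d (w i))) * (\<Sum>j<d. (y j)\<^sup>2)" .
    then show ?thesis unfolding eq by (rule mult_right_less_imp_less) (use y0 in simp)
  qed
  then show ?thesis
    unfolding signing_discrepancy_def using fin ne by (simp add: Min_gr_iff)
qed

section \<open>A tree of vectors that resolves the identity\<close>

text \<open>The branching number is \<open>q\<^sup>2\<close>. It is a square so that the factor \<open>q\<close> between consecutive levels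
  is rational.\<close>

locale signed_tree =
  fixes q :: nat and \<beta> \<gamma> :: real
  assumes q: "2 \<le> q" and \<beta>: "0 < \<beta>" and \<gamma>: "0 < \<gamma>" and circle: "\<beta>\<^sup>2 + \<gamma>\<^sup>2 = 1"
begin

text \<open>Heap numbering: the root is 0 and the children of \<open>j\<close> are \<open>q\<^sup>2 j + 1, \<dots>, q\<^sup>2 j + q\<^sup>2\<close>. If the
  vertices are the numbers below \<open>d\<close>, the numbers from \<open>d\<close> to \<open>q\<^sup>2 d\<close> are exactly the children that
  are no vertices themselves.\<close>

definition par :: "nat \<Rightarrow> nat" where
  "par c = (c - 1) div q\<^sup>2"

lemma par_less: "c \<noteq> 0 \<Longrightarrow> par c < c"
  unfolding par_def by (rule le_less_trans[OF div_le_dividend]) simp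

lemma par_bound: "c \<noteq> 0 \<Longrightarrow> c < q\<^sup>2 * D + 1 \<Longrightarrow> par c < D"
  using q by (auto simp: par_def less_mult_imp_div_less mult.commute)

lemma sum_over_children:
  fixes F :: "nat \<Rightarrow> real"
  shows "(\<Sum>c = 1..<q\<^sup>2 * D + 1. F (par c)) = q\<^sup>2 * (\<Sum>j<D. F j)"
proof (induction D)
  case (Suc D)
  have "par c = D" if "c \<in> {q\<^sup>2 * D + 1..<q\<^sup>2 * Suc D + 1}" for c
    using that unfolding par_def by (intro div_nat_eqI) (auto simp: algebra_simps)
  then have "(\<Sum>c = q\<^sup>2 * D + 1..<q\<^sup>2 * Suc D + 1. F (par c)) = q\<^sup>2 * F D"
    by simp
  moreover have "(\<Sum>c = 1..<q\<^sup>2 * Suc D + 1. F (par c)) = (\<Sum>c = 1..<q\<^sup>2 * D + 1. F (par c))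
      + (\<Sum>c = q\<^sup>2 * D + 1..<q\<^sup>2 * Suc D + 1. F (par c))"
    by (rule sum.atLeastLessThan_concat[symmetric]) auto
  ultimately show ?case using Suc by (simp add: algebra_simps)
qed simp

text \<open>The value at the parent, with the convention that the missing parent of the root has value 0.
  This makes the formulas for the root instances of the general ones.\<close>

definition up :: "(nat \<Rightarrow> real) \<Rightarrow> nat \<Rightarrow> real" where
  "up f c = (if c = 0 then 0 else f (par c))"

lemma sum_up:
  fixes f :: "nat \<Rightarrow> real"
  shows "(\<Sum>c<q\<^sup>2 * D + 1. up f c) = q\<^sup>2 * (\<Sum>j<D. f j)"
proof -
  have "(\<Sum>c<q\<^sup>2 * D + 1. up f c) = (\<Sum>c = 1..<q\<^sup>2 * D + 1. up f c)"
    by (rule sum.mono_neutral_right) (auto simp: up_def)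
  also have "\<dots> = (\<Sum>c = 1..<q\<^sup>2 * D + 1. f (par c))"
    by (rule sum.cong) (auto simp: up_def)
  finally show ?thesis unfolding sum_over_children .
qed

text \<open>The row \<open>node c\<close> expresses the vertex value \<open>x\<^sub>c\<close> in terms of the orthonormal coordinates
  \<open>y\<^sub>c = q x\<^sub>c + \<beta> x\<^sub>p\<close>; the recursion solves this equation for \<open>x\<^sub>c\<close>, see \<open>node_lift\<close> below.\<close>

function node :: "nat \<Rightarrow> nat \<Rightarrow> real" where
  "node c j = (of_bool (c = j) - \<beta> * (if c = 0 then 0 else node (par c) j)) / q"
  by auto
termination by (relation "measure fst") (auto simp: par_less)

declare node.simps [simp del]

lemma node_rec: "of_bool (c = j) = q * node c j + \<beta> * up (\<lambda>p. node p j) c"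
  using q by (subst node.simps) (simp add: up_def field_simps)

lemma node_above: "c < j \<Longrightarrow> node c j = 0"
proof (induction c rule: less_induct)
  case (less c)
  then show ?case using par_less[of c] by (subst node.simps) auto
qed

lemma node_self: "node c c = 1 / q"
  using node_above[of "par c" c] par_less[of c] by (subst node.simps) auto

lemma node_rational: "\<beta> \<in> \<rat> \<Longrightarrow> node c j \<in> \<rat>"
proof (induction c rule: less_induct)
  case (less c)
  then show ?case using par_less[of c] by (subst node.simps) auto
qed

text \<open>The vectors of the family, indexed by a vertex \<open>c < d\<close> for the edge above \<open>c\<close> and by \<open>c \<ge> d\<close> for a
  stub. The first case is the reading \<open>\<beta> q x\<^sub>c + x\<^sub>p\<close> (\<open>edge_inner\<close>), written in the coordinates \<open>y\<close>.\<close>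

definition edge :: "nat \<Rightarrow> nat \<Rightarrow> nat \<Rightarrow> real" where
  "edge d c j = (if c < d then \<beta> * of_bool (c = j) + \<gamma>\<^sup>2 * up (\<lambda>p. node p j) c
                 else \<gamma> * up (\<lambda>p. node p j) c)"

lemma edge_inner:
  assumes "c < d"
  shows "edge d c j = \<beta> * q * node c j + up (\<lambda>p. node p j) c"
proof -
  have "edge d c j = \<beta> * q * node c j + (\<beta>\<^sup>2 + \<gamma>\<^sup>2) * up (\<lambda>p. node p j) c"
    using assms unfolding edge_def node_rec by (simp add: algebra_simps power2_eq_square)
  then show ?thesis by (simp add: circle)
qed

lemma edge_rational: "\<beta> \<in> \<rat> \<Longrightarrow> \<gamma> \<in> \<rat> \<Longrightarrow> edge d c j \<in> \<rat>"
  by (simp add: edge_def up_def node_rational)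

lemma edge_nonzero:
  assumes "0 < d" "c < q\<^sup>2 * d + 1"
  shows "\<exists>j<d. edge d c j \<noteq> 0"
proof (cases "c < d")
  case True
  then have "edge d c c = \<beta>"
    using node_above[of "par c" c] par_less[of c] by (auto simp: edge_def up_def)
  then show ?thesis using True \<beta> by auto
next
  case False
  then have "c \<noteq> 0" using assms by auto
  then have "edge d c (par c) = \<gamma> / q" using False by (simp add: edge_def up_def node_self)
  moreover have "par c < d" using par_bound assms \<open>c \<noteq> 0\<close> by auto
  ultimately show ?thesis using \<gamma> q by (intro exI[of _ "par c"]) auto
qed

text \<open>An edge product differs from the product of the coordinates by \<open>\<gamma>\<^sup>2\<close> times the product at
  the parent minus \<open>\<gamma>\<^sup>2 q\<^sup>2\<close> times the product at the vertex. A stub contributes only the first of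
  these. In the sum over all edges and stubs every vertex occurs \<open>q\<^sup>2\<close> times as a parent, so the
  corrections cancel, wherever the tree is cut off.\<close>

lemma edges_resolve_identity:
  assumes "j < d" "k < d"
  shows "(\<Sum>c<q\<^sup>2 * d + 1. edge d c j * edge d c k) = (if j = k then 1 else 0)"
proof -
  define n where "n = q\<^sup>2 * d + 1"
  have dn: "d \<le> n" using q by (simp add: n_def le_SucI)
  define N where "N c = node c j * node c k" for c
  have inner: "edge d c j * edge d c k
      = of_bool (c = j) * of_bool (c = k) - q\<^sup>2 * \<gamma>\<^sup>2 * N c + \<gamma>\<^sup>2 * up N c" if "c < d" for c
  proof -
    have b: "\<beta>\<^sup>2 = 1 - \<gamma>\<^sup>2" using circle by simp
    have "up N c = up (\<lambda>p. node p j) c * up (\<lambda>p. node p k) c"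
      by (simp add: up_def N_def)
    moreover have "(\<beta> * q * X + Y) * (\<beta> * q * X' + Y')
       = (q * X + \<beta> * Y) * (q * X' + \<beta> * Y') - q\<^sup>2 * \<gamma>\<^sup>2 * (X * X') + \<gamma>\<^sup>2 * (Y * Y')"
      for X X' Y Y' :: real
    proof -
      have "(\<beta> * q * X + Y) * (\<beta> * q * X' + Y') - (q * X + \<beta> * Y) * (q * X' + \<beta> * Y')
        = (\<beta>\<^sup>2 - 1) * (q\<^sup>2 * (X * X') - Y * Y')"
        by (simp add: algebra_simps power2_eq_square)
      then show ?thesis by (simp add: b algebra_simps)
    qed
    ultimately show ?thesis
      unfolding edge_inner[OF that] node_rec[of c] N_def by simp
  qed
  have stub: "edge d c j * edge d c k = \<gamma>\<^sup>2 * up N c" if "\<not> c < d" for c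
    using that by (simp add: edge_def up_def N_def power2_eq_square)
  have "(\<Sum>c<n. edge d c j * edge d c k)
      = (\<Sum>c<n. (if c < d then of_bool (c = j) * of_bool (c = k) - q\<^sup>2 * \<gamma>\<^sup>2 * N c else 0)
            + \<gamma>\<^sup>2 * up N c)"
    by (rule sum.cong) (auto simp: inner stub)
  also have "\<dots> = (\<Sum>c<d. of_bool (c = j) * of_bool (c = k) - q\<^sup>2 * \<gamma>\<^sup>2 * N c)
      + \<gamma>\<^sup>2 * (\<Sum>c<n. up N c)"
    unfolding sum.distrib sum_distrib_left
    by (intro arg_cong2[of _ _ _ _ "(+)"] sum.mono_neutral_cong_right refl) (use dn in auto)
  also have "\<dots> = (\<Sum>c<d. of_bool (c = j) * of_bool (c = k))"
    unfolding n_def sum_up by (simp add: sum_subtractf mult_ac flip: sum_distrib_left sum_distrib_right)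
  also have "\<dots> = (if j = k then 1 else 0)"
  proof -
    have "(\<Sum>c<d. of_bool (c = j) * of_bool (c = k)) = (\<Sum>c<d. if c = j then of_bool (j = k) else 0 :: real)"
      by (rule sum.cong) auto
    also have "\<dots> = (if j = k then 1 else 0)" using assms by simp
    finally show ?thesis .
  qed
  finally show ?thesis unfolding n_def .
qed

lemma q_square_ge: "4 \<le> (real q)\<^sup>2"
  using power_mono[of 2 "real q" 2] q by simp

text \<open>The rows of the ancestors of \<open>c\<close> have no entry at position \<open>c\<close>, so the two summands of \<open>node c\<close> are
  orthogonal and the squared norms obey \<open>N\<^sub>c = (1 + \<beta>\<^sup>2 N\<^sub>p) / q\<^sup>2\<close>.\<close>

lemma node_norm: "(\<Sum>j<d. (node c j)\<^sup>2) \<le> 2 / q\<^sup>2"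
proof (induction c rule: less_induct)
  case (less c)
  have orth: "(of_bool (c = j) - \<beta> * up (\<lambda>p. node p j) c)\<^sup>2
      = of_bool (c = j) + \<beta>\<^sup>2 * (up (\<lambda>p. node p j) c)\<^sup>2" for j
    using node_above[of "par c" c] par_less[of c] by (auto simp: up_def power_mult_distrib)
  have up: "(\<Sum>j<d. (up (\<lambda>p. node p j) c)\<^sup>2) \<le> 2 / q\<^sup>2"
    using less[of "par c"] par_less[of c] by (cases "c = 0") (auto simp: up_def)
  have "(\<Sum>j<d. (node c j)\<^sup>2) = (\<Sum>j<d. of_bool (c = j) + \<beta>\<^sup>2 * (up (\<lambda>p. node p j) c)\<^sup>2) / q\<^sup>2"
    unfolding sum_divide_distrib by (subst node.simps) (simp add: power_divide orth[unfolded up_def] up_def)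
  also have "\<dots> = ((\<Sum>j<d. of_bool (c = j)) + \<beta>\<^sup>2 * (\<Sum>j<d. (up (\<lambda>p. node p j) c)\<^sup>2)) / q\<^sup>2"
    unfolding sum.distrib sum_distrib_left ..
  also have "\<dots> \<le> (1 + 1 * (2 / q\<^sup>2)) / q\<^sup>2"
  proof (intro divide_right_mono add_mono mult_mono up)
    show "\<beta>\<^sup>2 \<le> 1" using circle by (metis le_add_same_cancel1 zero_le_power2)
    show "(\<Sum>j<d. of_bool (c = j)) \<le> (1 :: real)"
      by (cases "c < d") (auto simp: of_bool_def)
  qed (auto intro: sum_nonneg)
  also have "\<dots> \<le> 2 / q\<^sup>2"
    using q_square_ge by (intro divide_right_mono) (auto simp: divide_simps)
  finally show ?case .
qed

lemma edge_norm: "(\<Sum>j<d. (edge d c j)\<^sup>2) \<le> \<beta>\<^sup>2 + 2 / q\<^sup>2"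
proof -
  have g1: "\<gamma>\<^sup>2 \<le> 1" using circle by (metis le_add_same_cancel2 zero_le_power2)
  then have g2: "(\<gamma>\<^sup>2)\<^sup>2 \<le> 1" using power_le_one[of "\<gamma>\<^sup>2" 2] by simp
  define u where "u j = up (\<lambda>p. node p j) c" for j
  have up: "(\<Sum>j<d. (u j)\<^sup>2) \<le> 2 / q\<^sup>2"
    using node_norm[of "par c" d] by (cases "c = 0") (auto simp: up_def u_def)
  have uc: "u c = 0"
    using node_above[of "par c" c] par_less[of c] by (auto simp: up_def u_def)
  have "(edge d c j)\<^sup>2 \<le> \<beta>\<^sup>2 * of_bool (c = j) + (u j)\<^sup>2" for j
  proof (cases "c < d")
    case True
    then have "(edge d c j)\<^sup>2 = \<beta>\<^sup>2 * of_bool (c = j) + (\<gamma>\<^sup>2)\<^sup>2 * (u j)\<^sup>2"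
      using uc unfolding edge_def u_def[symmetric] by (cases "c = j") (auto simp: power_mult_distrib)
    then show ?thesis using g2 by (simp add: mult_left_le_one_le)
  next
    case False
    then have "(edge d c j)\<^sup>2 = \<gamma>\<^sup>2 * (u j)\<^sup>2"
      by (simp add: edge_def u_def power_mult_distrib)
    also have "\<dots> \<le> (u j)\<^sup>2" using g1 by (simp add: mult_left_le_one_le)
    finally show ?thesis by (simp add: add_increasing)
  qed
  then have "(\<Sum>j<d. (edge d c j)\<^sup>2) \<le> (\<Sum>j<d. \<beta>\<^sup>2 * of_bool (c = j) + (u j)\<^sup>2)"
    by (intro sum_mono)
  also have "\<dots> = \<beta>\<^sup>2 * (\<Sum>j<d. of_bool (c = j)) + (\<Sum>j<d. (u j)\<^sup>2)"
    unfolding sum.distrib sum_distrib_left ..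
  also have "\<dots> \<le> \<beta>\<^sup>2 * 1 + 2 / q\<^sup>2"
    by (intro add_mono mult_left_mono up) (cases "c < d"; auto simp: of_bool_def)+
  finally show ?thesis by simp
qed

section \<open>A test vector for every signing\<close>

text \<open>The passage from vertex values \<open>x\<close> to the orthonormal coordinates \<open>y\<close>.\<close>

definition lift :: "(nat \<Rightarrow> real) \<Rightarrow> nat \<Rightarrow> real" where
  "lift x c = real q * x c + \<beta> * up x c"

lemma node_lift: "c < d \<Longrightarrow> (\<Sum>j<d. node c j * lift x j) = x c"
proof (induction c rule: less_induct)
  case (less c)
  have up: "(\<Sum>j<d. up (\<lambda>p. node p j) c * lift x j) = up x c"
    using less.IH[of "par c"] less.prems par_less[of c] by (auto simp: up_def)
  have "lift x c = (\<Sum>j<d. of_bool (c = j) * lift x j)"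
    using less.prems by (simp add: of_bool_def if_distrib[of "\<lambda>t. t * _"] cong: if_cong)
  also have "\<dots> = q * (\<Sum>j<d. node c j * lift x j) + \<beta> * (\<Sum>j<d. up (\<lambda>p. node p j) c * lift x j)"
    unfolding node_rec sum_distrib_left by (simp add: algebra_simps sum.distrib)
  finally have "real q * x c = real q * (\<Sum>j<d. node c j * lift x j)"
    unfolding up by (simp add: lift_def[of x c])
  then show ?case using q by simp
qed

lemma edge_lift:
  assumes "0 < d" "c < q\<^sup>2 * d + 1"
  shows "(\<Sum>j<d. edge d c j * lift x j) = (if c < d then \<beta> * q * x c + up x c else \<gamma> * up x c)"
proof -
  have up: "(\<Sum>j<d. up (\<lambda>p. node p j) c * lift x j) = up x c"
    using node_lift par_bound[of c d] assms by (auto simp: up_def)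
  show ?thesis
  proof (cases "c < d")
    case True
    have "(\<Sum>j<d. edge d c j * lift x j) = \<beta> * q * (\<Sum>j<d. node c j * lift x j)
        + (\<Sum>j<d. up (\<lambda>p. node p j) c * lift x j)"
      using True by (simp add: edge_inner algebra_simps sum.distrib sum_distrib_left)
    then show ?thesis using True by (simp add: up node_lift)
  next
    case False
    then have "(\<Sum>j<d. edge d c j * lift x j) = \<gamma> * (\<Sum>j<d. up (\<lambda>p. node p j) c * lift x j)"
      by (simp add: edge_def sum_distrib_left mult.assoc)
    then show ?thesis using False by (simp add: up)
  qed
qed

text \<open>The squares of the test values: every level of the tree has total weight 1.\<close>

function weight :: "nat \<Rightarrow> real" where
  "weight c = (if c = 0 then 1 else weight (par c) / q\<^sup>2)"
  by auto
termination by (relation "measure id") (auto simp: par_less)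

declare weight.simps [simp del]

text \<open>The number of vertices of depth at most \<open>l\<close>.\<close>

fun size_upto :: "nat \<Rightarrow> nat" where
  "size_upto 0 = 1"
| "size_upto (Suc l) = q\<^sup>2 * size_upto l + 1"

lemma size_upto_pos: "0 < size_upto l"
  by (cases l) auto

lemma sum_weight: "(\<Sum>c<size_upto l. weight c) = l + 1"
proof (induction l)
  case (Suc l)
  have "(\<Sum>c<size_upto (Suc l). weight c)
      = (\<Sum>c<size_upto (Suc l). (if c = 0 then 1 else 0) + up weight c / q\<^sup>2)"
    by (intro sum.cong refl) (subst weight.simps, simp add: up_def)
  also have "\<dots> = 1 + (\<Sum>c<q\<^sup>2 * size_upto l + 1. up weight c) / q\<^sup>2"
    by (simp add: sum.distrib sum_divide_distrib del: sum.lessThan_Suc)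
  also have "\<dots> = 1 + (\<Sum>c<size_upto l. weight c)"
    using q unfolding sum_up by simp
  finally show ?case using Suc by simp
qed (simp add: weight.simps)

lemma sum_up_weight: "(\<Sum>c<size_upto (Suc l). up weight c) = q\<^sup>2 * (real l + 1)"
  unfolding size_upto.simps sum_up sum_weight by simp

text \<open>The vertex values of the test vector. Their signs are multiplied along the path from the root, so
  that \<open>t\<^sub>c x\<^sub>c x\<^sub>p\<close> is nonnegative on every edge (\<open>spin_up\<close>).\<close>

function spin :: "(nat \<Rightarrow> real) \<Rightarrow> nat \<Rightarrow> real" where
  "spin t c = (if c = 0 then 1 else t c * spin t (par c) / q)"
  by auto
termination by (relation "measure snd") (auto simp: par_less)

declare spin.simps [simp del]

lemma spin_square:
  assumes "\<And>i. t i \<in> {-1, 1}"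
  shows "(spin t c)\<^sup>2 = weight c"
proof (induction c rule: less_induct)
  case (less c)
  have "(t c)\<^sup>2 = 1" using assms[of c] by auto
  then show ?case
    using less[of "par c"] par_less[of c]
    by (subst spin.simps, subst weight.simps) (auto simp: power_mult_distrib power_divide)
qed

lemma up_spin_square:
  "(\<And>i. t i \<in> {-1, 1}) \<Longrightarrow> (up (spin t) c)\<^sup>2 = up weight c"
  by (simp add: up_def spin_square)

lemma spin_up:
  assumes "\<And>i. t i \<in> {-1, 1}"
  shows "spin t c * up (spin t) c = t c * up weight c / q"
proof (cases "c = 0")
  case False
  then show ?thesis
    using spin_square[of t, OF assms, where c = "par c"]
    by (subst spin.simps) (simp add: up_def power2_eq_square)
qed (simp add: up_def)

lemma test_vector_norm:
  assumes t: "\<And>i. t i \<in> {-1, 1}"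
  shows "(\<Sum>c<size_upto (Suc l). (lift (spin t) c)\<^sup>2) \<le> q\<^sup>2 * ((real l + 2) * (1 + \<beta>)\<^sup>2)"
proof -
  have up0: "0 \<le> up weight c" for c
    using up_spin_square[OF t, where c = c] by (metis zero_le_power2)
  have "(lift (spin t) c)\<^sup>2 \<le> q\<^sup>2 * weight c + (\<beta>\<^sup>2 + 2 * \<beta>) * up weight c" for c
  proof -
    have "(lift (spin t) c)\<^sup>2 = q\<^sup>2 * (spin t c)\<^sup>2 + \<beta>\<^sup>2 * (up (spin t) c)\<^sup>2
        + 2 * \<beta> * (q * (spin t c * up (spin t) c))"
      by (simp add: lift_def power2_eq_square algebra_simps)
    also have "\<dots> = q\<^sup>2 * weight c + \<beta>\<^sup>2 * up weight c + 2 * \<beta> * (t c * up weight c)"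
      unfolding spin_square[OF t] up_spin_square[OF t] spin_up[OF t] using q by simp
    also have "t c * up weight c \<le> up weight c"
      using t[of c] up0[of c] by auto
    finally show ?thesis using \<beta> by (simp add: algebra_simps)
  qed
  then have "(\<Sum>c<size_upto (Suc l). (lift (spin t) c)\<^sup>2)
      \<le> (\<Sum>c<size_upto (Suc l). q\<^sup>2 * weight c + (\<beta>\<^sup>2 + 2 * \<beta>) * up weight c)"
    by (rule sum_mono)
  also have "\<dots> = q\<^sup>2 * (real l + 2) + (\<beta>\<^sup>2 + 2 * \<beta>) * (q\<^sup>2 * (real l + 1))"
    unfolding sum.distrib sum_distrib_left[symmetric] sum_up_weight sum_weight by simp
  also have "\<dots> \<le> q\<^sup>2 * (real l + 2) + (\<beta>\<^sup>2 + 2 * \<beta>) * (q\<^sup>2 * (real l + 2))"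
    using \<beta> by (intro add_left_mono mult_left_mono) auto
  also have "\<dots> = q\<^sup>2 * ((real l + 2) * (1 + \<beta>)\<^sup>2)"
    by (simp add: power2_eq_square algebra_simps)
  finally show ?thesis .
qed

text \<open>The signs \<open>t = \<sigma> s\<close> are used instead of \<open>s\<close>, where \<open>\<sigma>\<close> makes the part of the form that comes from
  the squares nonnegative. Its coefficients \<open>K\<close> involve only \<open>weight\<close> and not the signs, which is
  why \<open>\<sigma>\<close> can be chosen before the test vector.\<close>

lemma signed_lower_bound:
  fixes s :: "nat \<Rightarrow> real" and l :: nat
  assumes s: "\<And>i. s i \<in> {-1, 1}"
  defines "d \<equiv> size_upto (Suc l)"
  shows "\<exists>y. 0 < (\<Sum>j<d. (y j)\<^sup>2) \<and>
    2 * \<beta> * (real l + 1) / ((real l + 2) * (1 + \<beta>)\<^sup>2) * (\<Sum>j<d. (y j)\<^sup>2)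
      \<le> \<bar>\<Sum>c<q\<^sup>2 * d + 1. s c * (\<Sum>j<d. edge d c j * y j)\<^sup>2\<bar>"
proof -
  define n where "n = q\<^sup>2 * d + 1"
  have d0: "0 < d" unfolding d_def by (rule size_upto_pos)
  have dn: "d \<le> n" using q by (simp add: n_def le_SucI)
  define K where "K c = (if c < d then \<beta>\<^sup>2 * q\<^sup>2 * weight c + up weight c else \<gamma>\<^sup>2 * up weight c)" for c
  define \<sigma> :: real where "\<sigma> = (if 0 \<le> (\<Sum>c<n. s c * K c) then 1 else -1)"
  define t where "t c = \<sigma> * s c" for c
  have t: "t c \<in> {-1, 1}" for c
    using s[of c] by (auto simp: t_def \<sigma>_def)
  have bias: "0 \<le> (\<Sum>c<n. t c * K c)"
    by (simp add: t_def \<sigma>_def mult.assoc sum_negf)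
  define y where "y = lift (spin t)"
  have form: "t c * (\<Sum>j<d. edge d c j * y j)\<^sup>2
      = t c * K c + (if c < d then 2 * \<beta> * up weight c else 0)" if "c < n" for c
  proof (cases "c < d")
    case True
    have tt: "t c * t c = 1" using t[of c] by auto
    have "(\<Sum>j<d. edge d c j * y j)\<^sup>2 = (\<beta> * q * spin t c + up (spin t) c)\<^sup>2"
      using edge_lift[OF d0, of c] that True by (simp add: n_def y_def)
    also have "\<dots> = \<beta>\<^sup>2 * q\<^sup>2 * (spin t c)\<^sup>2 + (up (spin t) c)\<^sup>2
        + 2 * \<beta> * (q * (spin t c * up (spin t) c))"
      by (simp add: power2_eq_square algebra_simps)
    also have "\<dots> = K c + 2 * \<beta> * (t c * up weight c)"
      unfolding spin_square[OF t] up_spin_square[OF t] spin_up[OF t] using q True by (simp add: K_def)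
    finally have "t c * (\<Sum>j<d. edge d c j * y j)\<^sup>2 = t c * K c + 2 * \<beta> * (t c * t c) * up weight c"
      by (simp add: algebra_simps)
    then show ?thesis using True tt by simp
  next
    case False
    have "(\<Sum>j<d. edge d c j * y j)\<^sup>2 = \<gamma>\<^sup>2 * (up (spin t) c)\<^sup>2"
      using edge_lift[OF d0, of c] that False by (simp add: n_def y_def power_mult_distrib)
    then show ?thesis using False by (simp add: K_def up_spin_square[OF t])
  qed
  have "(\<Sum>c<n. t c * (\<Sum>j<d. edge d c j * y j)\<^sup>2)
      = (\<Sum>c<n. t c * K c) + (\<Sum>c<n. if c < d then 2 * \<beta> * up weight c else 0)"
    unfolding sum.distrib[symmetric] by (rule sum.cong) (auto simp: form)
  also have "(\<Sum>c<n. if c < d then 2 * \<beta> * up weight c else 0) = (\<Sum>c<d. 2 * \<beta> * up weight c)"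
    by (rule sum.mono_neutral_cong_right) (use dn in auto)
  also have "\<dots> = 2 * \<beta> * (q\<^sup>2 * (real l + 1))"
    unfolding sum_distrib_left[symmetric] d_def sum_up_weight ..
  finally have "2 * \<beta> * (q\<^sup>2 * (real l + 1)) \<le> (\<Sum>c<n. t c * (\<Sum>j<d. edge d c j * y j)\<^sup>2)"
    using bias by simp
  also have "\<dots> = \<sigma> * (\<Sum>c<n. s c * (\<Sum>j<d. edge d c j * y j)\<^sup>2)"
    by (simp add: t_def sum_distrib_left mult.assoc)
  also have "\<dots> \<le> \<bar>\<Sum>c<n. s c * (\<Sum>j<d. edge d c j * y j)\<^sup>2\<bar>"
    by (auto simp: \<sigma>_def)
  finally have low: "2 * \<beta> * (q\<^sup>2 * (real l + 1)) \<le> \<bar>\<Sum>c<n. s c * (\<Sum>j<d. edge d c j * y j)\<^sup>2\<bar>" .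
  define R where "R = (real l + 2) * (1 + \<beta>)\<^sup>2"
  have R: "0 < R" using \<beta> by (simp add: R_def)
  have "2 * \<beta> * (real l + 1) / R * (\<Sum>j<d. (y j)\<^sup>2) \<le> 2 * \<beta> * (real l + 1) / R * (q\<^sup>2 * R)"
    using test_vector_norm[OF t, where l = l] R \<beta>
    by (intro mult_left_mono) (auto simp: y_def d_def R_def)
  also have "\<dots> = 2 * \<beta> * (q\<^sup>2 * (real l + 1))"
    using R by simp
  also note low
  finally have "2 * \<beta> * (real l + 1) / R * (\<Sum>j<d. (y j)\<^sup>2)
      \<le> \<bar>\<Sum>c<n. s c * (\<Sum>j<d. edge d c j * y j)\<^sup>2\<bar>" .
  moreover have "0 < (\<Sum>j<d. (y j)\<^sup>2)"
  proof (rule sum_pos2[of _ 0])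
    show "0 < (y 0)\<^sup>2" using q by (simp add: y_def lift_def up_def spin.simps)
  qed (use d0 in auto)
  ultimately show ?thesis unfolding n_def R_def by (intro exI[of _ y] conjI)
qed


lemma max_trace_edges:
  assumes "0 < d"
  defines "A \<equiv> \<lambda>c. outer d (edge d c)"
  shows "0 < max_trace (q\<^sup>2 * d + 1) A" "max_trace (q\<^sup>2 * d + 1) A \<le> \<beta>\<^sup>2 + 2 / q\<^sup>2"
proof -
  have tr: "Re (mat_trace (A c)) = (\<Sum>j<d. (edge d c j)\<^sup>2)" for c
    unfolding A_def trace_outer by simp
  obtain j where "j < d" "edge d 0 j \<noteq> 0"
    using edge_nonzero[OF assms(1), of 0] by auto
  then have "0 < (\<Sum>j<d. (edge d 0 j)\<^sup>2)"
    by (intro sum_pos2[of _ j]) auto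
  then show "0 < max_trace (q\<^sup>2 * d + 1) A"
    unfolding max_trace_def tr by (subst Max_gr_iff) (auto simp: lessThan_empty_iff)
  show "max_trace (q\<^sup>2 * d + 1) A \<le> \<beta>\<^sup>2 + 2 / q\<^sup>2"
    unfolding max_trace_def tr using edge_norm by (subst Max_le_iff) (auto simp: lessThan_empty_iff)
qed

lemma discrepancy_edges:
  fixes l :: nat
  assumes "K < 2 * \<beta> * (real l + 1) / ((real l + 2) * (1 + \<beta>)\<^sup>2)"
  defines "d \<equiv> size_upto (Suc l)"
  shows "K < signing_discrepancy d (q\<^sup>2 * d + 1) (\<lambda>c. outer d (edge d c))"
proof (rule discrepancy_outer_gt)
  fix s :: "nat \<Rightarrow> real" assume s: "\<And>i. s i \<in> {-1, 1}"
  obtain y where y: "0 < (\<Sum>j<d. (y j)\<^sup>2)"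
    "2 * \<beta> * (real l + 1) / ((real l + 2) * (1 + \<beta>)\<^sup>2) * (\<Sum>j<d. (y j)\<^sup>2)
      \<le> \<bar>\<Sum>c<q\<^sup>2 * d + 1. s c * (\<Sum>j<d. edge d c j * y j)\<^sup>2\<bar>"
    using signed_lower_bound[of s l, OF s] unfolding d_def by (elim exE conjE)
  show "\<exists>y. 0 < (\<Sum>j<d. (y j)\<^sup>2) \<and>
      K * (\<Sum>j<d. (y j)\<^sup>2) < \<bar>\<Sum>c<q\<^sup>2 * d + 1. s c * (\<Sum>j<d. edge d c j * y j)\<^sup>2\<bar>"
    using y less_le_trans[OF mult_strict_right_mono[OF assms(1) y(1)] y(2)]
    by (intro exI[of _ y] conjI)
qed

end

section \<open>Choice of the parameters\<close>

text \<open>The points come from the usual parametrisation \<open>(2 k / (k\<^sup>2 + 1), (k\<^sup>2 - 1) / (k\<^sup>2 + 1))\<close>.\<close>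

lemma rational_circle_points:
  fixes \<delta> :: real
  assumes "0 < \<delta>"
  obtains \<beta> \<gamma> :: real where "0 < \<beta>" "\<beta> < \<delta>" "0 < \<gamma>" "\<beta>\<^sup>2 + \<gamma>\<^sup>2 = 1" "\<beta> \<in> \<rat>" "\<gamma> \<in> \<rat>"
proof -
  obtain k :: nat where k: "2 / \<delta> + 2 < real k" using reals_Archimedean2 by blast
  have k2: "2 < real k" using k divide_pos_pos[OF zero_less_numeral assms, of "num.Bit0 num.One"] by linarith
  define N where "N = (real k)\<^sup>2 + 1"
  have N: "0 < N" by (simp add: N_def add_nonneg_pos)
  show thesis
  proof (rule that[of "2 * k / N" "((real k)\<^sup>2 - 1) / N"])
    show "0 < 2 * k / N" using k2 N by simp
    have "2 / \<delta> < k" using k by simp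
    then have "2 < \<delta> * k" using assms by (simp add: pos_divide_less_eq mult.commute)
    then have "2 * k < \<delta> * k * k" using k2 by (simp add: mult_strict_right_mono)
    also have "\<dots> \<le> \<delta> * N" using assms by (simp add: N_def power2_eq_square algebra_simps)
    finally show "2 * k / N < \<delta>" using N by (simp add: divide_simps)
    have "1 < (real k)\<^sup>2" using k2 by (simp add: one_less_power)
    then show "0 < ((real k)\<^sup>2 - 1) / N" using N by simp
    have "(2 * real k)\<^sup>2 + ((real k)\<^sup>2 - 1)\<^sup>2 = N\<^sup>2"
      by (simp add: N_def power2_eq_square algebra_simps)
    then show "(2 * k / N)\<^sup>2 + (((real k)\<^sup>2 - 1) / N)\<^sup>2 = 1"
      using N by (simp add: power_divide flip: add_divide_distrib)
  qed (auto simp: N_def)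
qed

text \<open>First \<open>\<beta>\<close> is made so small that \<open>C < 2 / (1 + \<beta>)\<^sup>2\<close>. For this fixed \<open>\<beta>\<close>, both sides of the last
  inequality converge, to \<open>C \<beta>\<close> and \<open>2 \<beta> / (1 + \<beta>)\<^sup>2\<close>, as the branching and the depth tend to
  infinity; taking them equal leaves a single limit.\<close>

lemma good_parameters:
  fixes C \<epsilon>\<^sub>0 :: real
  assumes C: "0 < C" "C < 2" and "0 < \<epsilon>\<^sub>0"
  obtains q l :: nat and \<beta> \<gamma> :: real
  where "signed_tree q \<beta> \<gamma>" "\<beta> \<in> \<rat>" "\<gamma> \<in> \<rat>" "\<beta>\<^sup>2 + 2 / q\<^sup>2 < \<epsilon>\<^sub>0"
    "C * sqrt (\<beta>\<^sup>2 + 2 / q\<^sup>2) < 2 * \<beta> * (real l + 1) / ((real l + 2) * (1 + \<beta>)\<^sup>2)"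
proof -
  define \<delta> where "\<delta> = min (sqrt (2 / C) - 1) (sqrt \<epsilon>\<^sub>0)"
  have "0 < \<delta>" using assms by (simp add: \<delta>_def)
  then obtain \<beta> \<gamma> :: real where bg: "0 < \<beta>" "\<beta> < \<delta>" "0 < \<gamma>" "\<beta>\<^sup>2 + \<gamma>\<^sup>2 = 1" "\<beta> \<in> \<rat>" "\<gamma> \<in> \<rat>"
    using rational_circle_points by blast
  have "1 + \<beta> < sqrt (2 / C)" using bg by (simp add: \<delta>_def)
  then have "(1 + \<beta>)\<^sup>2 < (sqrt (2 / C))\<^sup>2" using bg by (intro power_strict_mono) auto
  then have "C * (1 + \<beta>)\<^sup>2 < 2" using C by (simp add: field_simps)
  then have gap: "C * \<beta> - 2 * \<beta> * 1 / (1 + \<beta>)\<^sup>2 < 0"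
    using bg(1) by (simp add: field_simps)
  have "\<beta>\<^sup>2 < (sqrt \<epsilon>\<^sub>0)\<^sup>2" using bg by (intro power_strict_mono) (auto simp: \<delta>_def)
  then have small: "\<beta>\<^sup>2 < \<epsilon>\<^sub>0" using assms by simp
  have "(\<lambda>k. 2 * (1 / real k * (1 / real k))) \<longlonglongrightarrow> 2 * (0 * 0)"
    by (intro tendsto_intros lim_1_over_n)
  then have "(\<lambda>k. \<beta>\<^sup>2 + 2 / (real k)\<^sup>2) \<longlonglongrightarrow> \<beta>\<^sup>2 + 0"
    by (intro tendsto_add tendsto_const) (simp add: power2_eq_square)
  then have eps: "(\<lambda>k. \<beta>\<^sup>2 + 2 / (real k)\<^sup>2) \<longlonglongrightarrow> \<beta>\<^sup>2" by simp
  have "(\<lambda>k. C * sqrt (\<beta>\<^sup>2 + 2 / (real k)\<^sup>2) - 2 * \<beta> * (real (Suc k) / real (Suc (Suc k))) / (1 + \<beta>)\<^sup>2)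
      \<longlonglongrightarrow> C * sqrt (\<beta>\<^sup>2) - 2 * \<beta> * 1 / (1 + \<beta>)\<^sup>2"
    using bg(1) by (intro tendsto_intros eps LIMSEQ_Suc[OF LIMSEQ_n_over_Suc_n]) auto
  then have "(\<lambda>k. C * sqrt (\<beta>\<^sup>2 + 2 / (real k)\<^sup>2) - 2 * \<beta> * (real (Suc k) / real (Suc (Suc k))) / (1 + \<beta>)\<^sup>2)
      \<longlonglongrightarrow> C * \<beta> - 2 * \<beta> * 1 / (1 + \<beta>)\<^sup>2"
    using bg(1) by simp
  from order_tendstoD(2)[OF this gap] order_tendstoD(2)[OF eps small] eventually_ge_at_top[of 2]
  have "\<forall>\<^sub>F k in sequentially. 2 \<le> k \<and> \<beta>\<^sup>2 + 2 / (real k)\<^sup>2 < \<epsilon>\<^sub>0 \<and>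
      C * sqrt (\<beta>\<^sup>2 + 2 / (real k)\<^sup>2) - 2 * \<beta> * (real (Suc k) / real (Suc (Suc k))) / (1 + \<beta>)\<^sup>2 < 0"
    by eventually_elim (intro conjI)
  then obtain k where k: "2 \<le> k" "\<beta>\<^sup>2 + 2 / (real k)\<^sup>2 < \<epsilon>\<^sub>0"
    "C * sqrt (\<beta>\<^sup>2 + 2 / (real k)\<^sup>2) - 2 * \<beta> * (real (Suc k) / real (Suc (Suc k))) / (1 + \<beta>)\<^sup>2 < 0"
    using eventually_happens'[OF sequentially_bot] by blast
  have "2 * \<beta> * (real (Suc k) / real (Suc (Suc k))) / (1 + \<beta>)\<^sup>2
      = 2 * \<beta> * (real k + 1) / ((real k + 2) * (1 + \<beta>)\<^sup>2)"
    by (simp add: add_ac)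
  then show thesis
    using k bg by (intro that[of k \<beta> \<gamma> k]) (auto simp: signed_tree_def)
qed

section \<open>Sharpness of the constant 2\<close>

theorem propositionC1:
  shows "(\<forall>C \<epsilon>\<^sub>0 :: real. 0 < C \<longrightarrow> C < 2 \<longrightarrow> 0 < \<epsilon>\<^sub>0 \<longrightarrow>
           (\<exists>(n::nat) (d::nat) (A :: nat \<Rightarrow> complex mat).
              n \<ge> 1 \<and> d \<ge> 1 \<and>
              (\<forall>i<n. rational_mat (A i) \<and> vec_space.rank d (A i) = 1) \<and>
              psd_resolution d n A \<and>
              0 < max_trace n A \<and> max_trace n A < \<epsilon>\<^sub>0 \<and>
              signing_discrepancy d n A > C * sqrt (max_trace n A)))
       \<and> (\<forall>C::real. universal_KS_signing_coefficient C \<longrightarrow> C \<ge> 2)"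
proof -
  have sharp: "\<exists>(n::nat) (d::nat) (A :: nat \<Rightarrow> complex mat).
              n \<ge> 1 \<and> d \<ge> 1 \<and>
              (\<forall>i<n. rational_mat (A i) \<and> vec_space.rank d (A i) = 1) \<and>
              psd_resolution d n A \<and>
              0 < max_trace n A \<and> max_trace n A < \<epsilon>\<^sub>0 \<and>
              signing_discrepancy d n A > C * sqrt (max_trace n A)"
    if C: "0 < C" "C < 2" and "0 < \<epsilon>\<^sub>0" for C \<epsilon>\<^sub>0 :: real
  proof -
    obtain q l :: nat and \<beta> \<gamma> :: real where par: "signed_tree q \<beta> \<gamma>" "\<beta> \<in> \<rat>" "\<gamma> \<in> \<rat>"
      "\<beta>\<^sup>2 + 2 / q\<^sup>2 < \<epsilon>\<^sub>0"
      "C * sqrt (\<beta>\<^sup>2 + 2 / q\<^sup>2) < 2 * \<beta> * (real l + 1) / ((real l + 2) * (1 + \<beta>)\<^sup>2)"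
      by (rule good_parameters[OF C \<open>0 < \<epsilon>\<^sub>0\<close>])
    interpret signed_tree q \<beta> \<gamma> by (rule par(1))
    define d where "d = size_upto (Suc l)"
    define n where "n = q\<^sup>2 * d + 1"
    define A where "A c = outer d (edge d c)" for c
    have d: "0 < d" unfolding d_def by (rule size_upto_pos)
    have "rational_mat (A c) \<and> vec_space.rank d (A c) = 1" if "c < n" for c
    proof
      show "rational_mat (A c)"
        unfolding A_def by (intro rational_outer edge_rational par)
      show "vec_space.rank d (A c) = 1"
        using edge_nonzero[OF d that[unfolded n_def]] unfolding A_def
        by (elim exE conjE) (rule rank_outer)
    qed
    moreover have "psd_resolution d n A"
      unfolding A_def n_def by (intro resolution_outer edges_resolve_identity)
    moreover have tr: "0 < max_trace n A" "max_trace n A \<le> \<beta>\<^sup>2 + 2 / q\<^sup>2"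
      unfolding A_def n_def by (rule max_trace_edges[OF d])+
    moreover have "C * sqrt (max_trace n A) < signing_discrepancy d n A"
    proof -
      have "C * sqrt (max_trace n A) \<le> C * sqrt (\<beta>\<^sup>2 + 2 / q\<^sup>2)"
        using tr(2) C by (intro mult_left_mono) auto
      also have "\<dots> < signing_discrepancy d n A"
        unfolding A_def n_def d_def by (rule discrepancy_edges[OF par(5)])
      finally show ?thesis .
    qed
    ultimately show ?thesis
      using d par(4) by (intro exI[of _ n] exI[of _ d] exI[of _ A]) (auto simp: n_def)
  qed
  moreover have "C \<ge> 2" if univ: "universal_KS_signing_coefficient C" for C
  proof (rule ccontr)
    assume "\<not> C \<ge> 2"
    \<comment> \<open>Sharpness concerns positive constants only; the maximum with 1 covers \<open>C \<le> 0\<close>.\<close>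
    then have C': "0 < max C 1" "max C 1 < 2" by auto
    obtain n d :: nat and A :: "nat \<Rightarrow> complex mat" where A: "n \<ge> 1" "d \<ge> 1"
      "psd_resolution d n A" "0 < max_trace n A"
      "signing_discrepancy d n A > max C 1 * sqrt (max_trace n A)"
      using sharp[OF C' C'(1)] by (elim exE conjE)
    have "C * sqrt (max_trace n A) \<le> max C 1 * sqrt (max_trace n A)"
      using A(4) by (intro mult_right_mono) auto
    moreover have "signing_discrepancy d n A \<le> C * sqrt (max_trace n A)"
      using univ A(1-3) unfolding universal_KS_signing_coefficient_def by blast
    ultimately show False using A(5) by linarith
  qed
  ultimately show ?thesis by blast
qed

end
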